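(* Let $g,q,b\in\mathbb{R}$, let $u$ be the solution of $(S)$, and for $h=x_0/n$ ($n\ge1$ an integer) let $\widetilde u^h$ be the modified piecewise linear discrete approximation. Then $$\|u-\widetilde u^h\|_H\le D_1h^2,\qquad\left\|\frac{\partial u}{\partial x}-\frac{\partial\widetilde u^h}{\partial x}\right\|_H\le\widetilde D_1h,$$ where $D_1=\sqrt{\tfrac{x_0y_0}{120}}\,|g|$ and $\widetilde D_1=\sqrt{\tfrac{x_0y_0}{12}}\,|g|$.
   Context: Fix $x_0,y_0>0$, $\Omega=(0,x_0)\times(0,y_0)$, $\Gamma_1=\{0\}\times(0,y_0]$, $\Gamma_2=\{x_0\}\times(0,y_0]$, $\Gamma_3=[0,x_0]\times\{0,y_0\}$, $H=L^2(\Omega)$ with its standard norm. For constants $g,q,b\in\mathbb{R}$, system $(S)$ is $-\Delta u=g$ in $\Omega$, $u=b$ on $\Gamma_1$, $-\partial u/\partial n=q$ on $\Gamma_2$, $-\partial u/\partial n=0$ on $\Gamma_3$; its solution is $u(x,y)=-\tfrac12gx^2+(gx_0-q)x+b$. For an integer $n\ge1$ put $h=x_0/n$, $x_i=(i-1)h$, $i=1,\dots,n+1$. The modified discrete system is: $\widetilde u^h_1=b$; $\widetilde u^h_{i+1}-2\widetilde u^h_i+\widetilde u^h_{i-1}=-gh^2$ for $i=2,\dots,n$; and $-\widetilde u^h_n+\widetilde u^h_{n+1}=\tfrac{gh^2}2-qh$ (obtained by combining the interior equation at $i=n$ with the three-point backward Neumann approximation $3\widetilde u^h_{n+1}-4\widetilde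 u^h_n+\widetilde u^h_{n-1}=-2qh$). Its solution is $\widetilde u^h_i=b+(i-1)h(gx_0-q)-\tfrac{gh^2}2(i-1)^2$. The function $\widetilde u^h$ is the piecewise linear interpolant: $\widetilde u^h(x,y)=\left(gx_0-q-(2i-1)\tfrac{gh}2\right)x+\tfrac{gh^2}2i(i-1)+b$ for $x\in[x_i,x_{i+1}]$, $y\in[0,y_0]$, $i=1,\dots,n$; its $x$-derivative is piecewise constant, defined a.e. *)

theory Defs
  imports "HOL-Analysis.Analysis"
begin

definition rect :: "real \<Rightarrow> real \<Rightarrow> (real \<times> real) set" where
  "rect x0 y0 = {0<..<x0} \<times> {0<..<y0}"

definition partial_x :: "(real \<times> real \<Rightarrow> real) \<Rightarrow> real \<times> real \<Rightarrow> real" where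
  "partial_x f = (\<lambda>(x, y). deriv (\<lambda>s. f (s, y)) x)"

definition partial_y :: "(real \<times> real \<Rightarrow> real) \<Rightarrow> real \<times> real \<Rightarrow> real" where
  "partial_y f = (\<lambda>(x, y). deriv (\<lambda>t. f (x, t)) y)"

definition laplacian :: "(real \<times> real \<Rightarrow> real) \<Rightarrow> real \<times> real \<Rightarrow> real" where
  "laplacian f z = partial_x (partial_x f) z + partial_y (partial_y f) z"

text \<open>On open sets the next two predicates are the classes \<open>C\<^sup>1\<close> and \<open>C\<^sup>2\<close>.  Existence of
  the partial derivatives is demanded separately because \<^const>\<open>deriv\<close> is total.\<close>

definition C1_on :: "(real \<times> real) set \<Rightarrow> (real \<times> real \<Rightarrow> real) \<Rightarrow> bool" where
  "C1_on S f \<longleftrightarrow>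
     (\<forall>(x, y) \<in> S. (\<lambda>s. f (s, y)) differentiable (at x) \<and> (\<lambda>t. f (x, t)) differentiable (at y)) \<and>
     continuous_on S (partial_x f) \<and> continuous_on S (partial_y f)"

definition C2_on :: "(real \<times> real) set \<Rightarrow> (real \<times> real \<Rightarrow> real) \<Rightarrow> bool" where
  "C2_on S f \<longleftrightarrow> C1_on S f \<and> C1_on S (partial_x f) \<and> C1_on S (partial_y f)"

text \<open>\<open>\<partial>f/\<partial>n = d\<close> at a boundary point \<open>z\<close> with outward unit normal \<open>v\<close>.  The difference
  quotient is one-sided: only points \<open>z - t v\<close> with \<open>t > 0\<close>, in the closed domain, are used.\<close>

definition has_normal_derivative ::
    "(real \<times> real \<Rightarrow> real) \<Rightarrow> real \<Rightarrow> real \<times> real \<Rightarrow> real \<times> real \<Rightarrow> bool" where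
  "has_normal_derivative f d z v \<longleftrightarrow>
     ((\<lambda>t. (f z - f (z - t *\<^sub>R v)) / t) \<longlongrightarrow> d) (at_right 0)"

text \<open>Classical solutions of the mixed problem \<open>(S)\<close>.  At the two corners with \<open>x = x0\<close> each
  side is taken with its own normal.\<close>

definition solves_S ::
    "real \<Rightarrow> real \<Rightarrow> real \<Rightarrow> real \<Rightarrow> real \<Rightarrow> (real \<times> real \<Rightarrow> real) \<Rightarrow> bool" where
  "solves_S x0 y0 g q b u \<longleftrightarrow>
     continuous_on (closure (rect x0 y0)) u \<and>
     C2_on (rect x0 y0) u \<and>
     (\<forall>z \<in> rect x0 y0. - laplacian u z = g) \<and>
     (\<forall>z \<in> {0} \<times> {0<..y0}. u z = b) \<and>
     (\<forall>z \<in> {x0} \<times> {0<..y0}. has_normal_derivative u (- q) z (1, 0)) \<and>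
     (\<forall>z \<in> {0..x0} \<times> {0}. has_normal_derivative u 0 z (0, - 1)) \<and>
     (\<forall>z \<in> {0..x0} \<times> {y0}. has_normal_derivative u 0 z (0, 1))"

text \<open>Nodal values \<open>U 1, \<dots>, U (n + 1)\<close>; the value \<open>U 0\<close> plays no role.\<close>

definition solves_modified_discrete ::
    "real \<Rightarrow> real \<Rightarrow> real \<Rightarrow> real \<Rightarrow> nat \<Rightarrow> (nat \<Rightarrow> real) \<Rightarrow> bool" where
  "solves_modified_discrete g q b h n U \<longleftrightarrow>
     U 1 = b \<and>
     (\<forall>i \<in> {2..n}. U (i + 1) - 2 * U i + U (i - 1) = - g * h\<^sup>2) \<and>
     - U n + U (n + 1) = g * h\<^sup>2 / 2 - q * h"

definition node :: "real \<Rightarrow> nat \<Rightarrow> real" where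
  "node h i = (real i - 1) * h"

definition piecewise_linear_interpolant ::
    "real \<Rightarrow> real \<Rightarrow> nat \<Rightarrow> (nat \<Rightarrow> real) \<Rightarrow> (real \<times> real \<Rightarrow> real) \<Rightarrow> bool" where
  "piecewise_linear_interpolant y0 h n U v \<longleftrightarrow>
     (\<forall>i \<in> {1..n}. \<forall>x \<in> {node h i..node h (i + 1)}. \<forall>y \<in> {0..y0}.
        v (x, y) = U i + (U (i + 1) - U i) / h * (x - node h i))"

text \<open>The Lebesgue integral is \<open>0\<close> for non-integrable functions, so \<open>L2_norm_on\<close> is meaningful
  only together with \<open>in_L2_on\<close>.\<close>

definition in_L2_on :: "(real \<times> real) set \<Rightarrow> (real \<times> real \<Rightarrow> real) \<Rightarrow> bool" where
  "in_L2_on S f \<longleftrightarrow>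
     set_borel_measurable lebesgue S f \<and> set_integrable lebesgue S (\<lambda>z. (f z)\<^sup>2)"

definition L2_norm_on :: "(real \<times> real) set \<Rightarrow> (real \<times> real \<Rightarrow> real) \<Rightarrow> real" where
  "L2_norm_on S f = sqrt (LINT z:S|lebesgue. (f z)\<^sup>2)"

text \<open>The closed-form solutions show that the systems above are solvable.\<close>

lemma solves_S_explicit:
  assumes "x0 > 0" "y0 > 0"
  shows "solves_S x0 y0 g q b (\<lambda>(x, y). - g / 2 * x\<^sup>2 + (g * x0 - q) * x + b)"
proof -
  let ?u = "\<lambda>(x, y). - g / 2 * x\<^sup>2 + (g * x0 - q) * x + b :: real"
  have d1: "((\<lambda>s. - g / 2 * s\<^sup>2 + (g * x0 - q) * s + b) has_real_derivative (- g * x + (g * x0 - q))) (at x)" for x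
    by (auto intro!: derivative_eq_intros)
  have d2: "((\<lambda>s. - g * s + (g * x0 - q)) has_real_derivative (- g)) (at x)" for x
    by (auto intro!: derivative_eq_intros)
  have px: "partial_x ?u = (\<lambda>(x, y). - g * x + (g * x0 - q))"
    unfolding partial_x_def using DERIV_imp_deriv[OF d1] by auto
  have py: "partial_y ?u = (\<lambda>_. 0)"
    unfolding partial_y_def by auto
  have pxx: "partial_x (\<lambda>(x, y). - g * x + (g * x0 - q)) = (\<lambda>_. - g)"
    unfolding partial_x_def using DERIV_imp_deriv[OF d2] by auto
  have pxy: "partial_y (\<lambda>(x, y). - g * x + (g * x0 - q)) = (\<lambda>_. 0)"
    unfolding partial_y_def by auto
  have p0: "partial_x (\<lambda>_. 0) = (\<lambda>_. 0)" "partial_y (\<lambda>_. 0) = (\<lambda>_. 0)"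
    unfolding partial_x_def partial_y_def by auto
  have D1: "(\<lambda>s. - g / 2 * s\<^sup>2 + (g * x0 - q) * s + b) differentiable (at x)" for x
    using d1 real_differentiable_def by blast
  have D2: "(\<lambda>s. - g * s + (g * x0 - q)) differentiable (at x)" for x
    using d2 real_differentiable_def by blast
  have C: "continuous_on S (\<lambda>(x, y). - g * x + (g * x0 - q))" for S :: "(real \<times> real) set"
    by (auto simp: case_prod_unfold intro!: continuous_intros)
  have C2: "C2_on S ?u" for S
    unfolding C2_on_def C1_on_def px py pxx pxy p0
    using D1 D2 C by (simp add: case_prod_unfold continuous_on_const)
  have n0: "has_normal_derivative ?u 0 z (0, c)" for z c
    unfolding has_normal_derivative_def by (cases z) auto
  have "((\<lambda>t. (?u (x0, y) - ?u ((x0, y) - t *\<^sub>R (1, 0))) / t) \<longlongrightarrow> - q) (at_right 0)" for y :: real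
  proof -
    have "((\<lambda>t. - q + g / 2 * t) \<longlongrightarrow> - q + g / 2 * 0) (at_right 0)"
      by (intro tendsto_intros)
    moreover have "\<forall>\<^sub>F t in at_right 0.
        (?u (x0, y) - ?u ((x0, y) - t *\<^sub>R (1, 0))) / t = - q + g / 2 * t"
      unfolding eventually_at_right_field
      by (rule exI[of _ 1]) (auto simp: field_simps power2_eq_square)
    ultimately show ?thesis
      by (simp add: tendsto_cong)
  qed
  moreover have "continuous_on S ?u" for S
    by (auto simp: case_prod_unfold intro!: continuous_intros)
  ultimately show ?thesis
    unfolding solves_S_def laplacian_def px py pxx p0
    using C2 n0 by (auto simp: has_normal_derivative_def)
qed

lemma solves_modified_discrete_explicit:
  "solves_modified_discrete g q b h n
     (\<lambda>i. b + (real i - 1) * h * (g * (real n * h) - q) - g * h\<^sup>2 / 2 * (real i - 1)\<^sup>2)"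
  unfolding solves_modified_discrete_def
  by (auto simp: of_nat_diff field_simps power2_eq_square)

end

theory Submission
  imports Defs
begin

text \<open>Both inequalities are in fact equalities.  The solution of the mixed problem is a quadratic
  function of \<open>x\<close>, the discrete system reproduces its values at the nodes exactly, and so \<open>uh\<close> is
  the linear interpolant of \<open>u\<close>.  With \<open>t\<close> the distance to the left node of a strip, the error
  is the parabola \<open>g / 2 * t * (h - t)\<close> (lemma \<open>interpolation_error_on_strip\<close>) and the error of the
  \<open>x\<close>-derivative is the line \<open>g * (h / 2 - t)\<close>.  These profiles are the same on every strip, their
  squares have integrals \<open>g\<^sup>2 * h ^ 5 / 120\<close> and \<open>g\<^sup>2 * h ^ 3 / 12\<close> over \<open>[0, h]\<close>, and
  multiplication by \<open>n * y0 = x0 * y0 / h\<close> gives the squared norms over the rectangle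
  (lemma \<open>L2_norm_on_periodic_profile\<close>).

  The remaining point is that a classical solution \<open>u\<close> \<^emph>\<open>is\<close> the quadratic one, that is,
  uniqueness for the mixed problem.  The derivatives of \<open>u\<close> are not assumed to extend
  continuously to the boundary, so instead of an energy argument a maximum principle
  (lemma \<open>mixed_max_principle\<close>) is applied to the difference of two solutions.  Adding a small
  multiple of a strictly subharmonic barrier with negative outward derivative on the three
  Neumann sides forces the maximum onto the Dirichlet side.  This avoids the Hopf boundary lemma
  and treats the corners like any other point of a Neumann side.\<close>

section \<open>A maximum principle for the mixed problem\<close>

text \<open>Otherwise \<open>f'\<close>, which vanishes at \<open>x\<close>, would be positive just to the right of \<open>x\<close>, and
  \<open>f\<close> would increase there.\<close>

lemma second_derivative_nonpos_at_local_max: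
  fixes f f' :: "real \<Rightarrow> real"
  assumes ab: "a < x" "x < b"
    and f': "\<And>s. a < s \<Longrightarrow> s < b \<Longrightarrow> (f has_real_derivative f' s) (at s)"
    and f'': "(f' has_real_derivative d) (at x)"
    and max: "\<And>s. a < s \<Longrightarrow> s < b \<Longrightarrow> f s \<le> f x"
  shows "d \<le> 0"
proof (rule ccontr)
  assume "\<not> d \<le> 0"
  then obtain e where e: "e > 0" "\<And>t. 0 < t \<Longrightarrow> t < e \<Longrightarrow> f' x < f' (x + t)"
    using DERIV_pos_inc_right[OF f''] by auto
  have "f' x = 0"
  proof (rule DERIV_local_max[OF f'[OF ab]])
    show "0 < min (x - a) (b - x)" using ab by simp
    show "\<forall>y. \<bar>x - y\<bar> < min (x - a) (b - x) \<longrightarrow> f y \<le> f x"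
      using max by auto
  qed
  define c where "c = x + min e (b - x) / 2"
  have c: "x < c" "c < b" "c < x + e"
    using ab e(1) by (auto simp: c_def min_def field_simps)
  have "f x < f c"
  proof (rule DERIV_pos_imp_increasing_open[OF c(1)])
    fix s assume s: "x < s" "s < c"
    then have "f' s > 0"
      using e(2)[of "s - x"] \<open>f' x = 0\<close> c by simp
    then show "\<exists>y. (f has_real_derivative y) (at s) \<and> 0 < y"
      using f'[of s] s ab c by auto
  next
    show "continuous_on {x..c} f"
      using f' ab c by (intro DERIV_atLeastAtMost_imp_continuous_on) (meson le_less_trans less_le_trans)
  qed
  with max[of c] ab c show False by simp
qed

lemma has_normal_derivative_add_cmult:
  assumes "has_normal_derivative f d z v" "has_normal_derivative f' d' z v"
  shows "has_normal_derivative (\<lambda>z. f z + c * f' z) (d + c * d') z v"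
  using tendsto_add[OF assms(1)[unfolded has_normal_derivative_def]
      tendsto_mult_left[OF assms(2)[unfolded has_normal_derivative_def], of c]]
  by (simp add: has_normal_derivative_def diff_divide_distrib add_divide_distrib algebra_simps)

lemma has_normal_derivative_diff:
  assumes "has_normal_derivative f d z v" "has_normal_derivative f' d' z v"
  shows "has_normal_derivative (\<lambda>z. f z - f' z) (d - d') z v"
  using has_normal_derivative_add_cmult[OF assms, of "- 1"] by simp

lemma has_normal_derivative_nonneg_at_max:
  assumes "has_normal_derivative f d z v" and "e > 0"
    and "\<And>t. 0 < t \<Longrightarrow> t < e \<Longrightarrow> f (z - t *\<^sub>R v) \<le> f z"
  shows "d \<ge> 0"
proof (rule tendsto_lowerbound[OF assms(1)[unfolded has_normal_derivative_def]])
  show "\<forall>\<^sub>F t in at_right 0. 0 \<le> (f z - f (z - t *\<^sub>R v)) / t"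
    unfolding eventually_at_right_field using assms(2,3) by (intro exI[of _ e]) auto
qed simp

lemma has_normal_derivative_quadratic:
  assumes "\<And>t. t > 0 \<Longrightarrow> f z - f (z - t *\<^sub>R v) = d * t + k * t\<^sup>2"
  shows "has_normal_derivative f d z v"
proof -
  have "((\<lambda>t. d + k * t) \<longlongrightarrow> d + k * 0) (at_right 0)"
    by (intro tendsto_intros)
  moreover have "\<forall>\<^sub>F t in at_right 0. (f z - f (z - t *\<^sub>R v)) / t = d + k * t"
    unfolding eventually_at_right_field using assms
    by (intro exI[of _ 1]) (auto simp: field_simps power2_eq_square)
  ultimately show ?thesis
    unfolding has_normal_derivative_def by (simp add: tendsto_cong)
qed

text \<open>The Laplacian is \<open>4 - 2 > 0\<close>.  The concave part in \<open>y\<close> makes the outward derivative negative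
  on the two horizontal sides; the convex part in \<open>x\<close> outweighs it in the Laplacian, and its
  linear term makes it decrease all the way to \<open>x = x0\<close>.\<close>

definition barrier :: "real \<Rightarrow> real \<Rightarrow> real \<times> real \<Rightarrow> real" where
  "barrier x0 y0 = (\<lambda>(x, y). 2 * x\<^sup>2 - 5 * x0 * x + y * (y0 - y))"

lemma barrier_normal_derivative:
  shows "has_normal_derivative (barrier x0 y0) (- x0) (x0, y) (1, 0)"
    and "has_normal_derivative (barrier x0 y0) (- y0) (x, 0) (0, - 1)"
    and "has_normal_derivative (barrier x0 y0) (- y0) (x, y0) (0, 1)"
  by (rule has_normal_derivative_quadratic[where k = "-2"]
           has_normal_derivative_quadratic[where k = 1],
      simp add: barrier_def algebra_simps power2_eq_square)+

text \<open>Let \<open>m\<close> be a maximum point of \<open>v = w + e * barrier\<close>.  On a Neumann side the outward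
  derivative of \<open>v\<close> is strictly negative, whereas at a maximum it is nonnegative; at an interior
  maximum both second derivatives of \<open>v\<close> would be nonpositive, whereas the Laplacian of \<open>v\<close> is
  positive.  So \<open>m\<close> lies on the Dirichlet side, where \<open>v\<close> is at most \<open>e * y0\<^sup>2\<close>, and it remains to
  let \<open>e\<close> tend to \<open>0\<close>.\<close>

lemma mixed_max_principle:
  fixes w wx wy wxx wyy :: "real \<times> real \<Rightarrow> real"
  assumes pos: "x0 > 0" "y0 > 0"
    and cont: "continuous_on ({0..x0} \<times> {0..y0}) w"
    and wx: "\<And>x y. (x, y) \<in> rect x0 y0 \<Longrightarrow>
      ((\<lambda>s. w (s, y)) has_real_derivative wx (x, y)) (at x)"
    and wxx: "\<And>x y. (x, y) \<in> rect x0 y0 \<Longrightarrow>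
      ((\<lambda>s. wx (s, y)) has_real_derivative wxx (x, y)) (at x)"
    and wy: "\<And>x y. (x, y) \<in> rect x0 y0 \<Longrightarrow>
      ((\<lambda>t. w (x, t)) has_real_derivative wy (x, y)) (at y)"
    and wyy: "\<And>x y. (x, y) \<in> rect x0 y0 \<Longrightarrow>
      ((\<lambda>t. wy (x, t)) has_real_derivative wyy (x, y)) (at y)"
    and subharmonic: "\<And>z. z \<in> rect x0 y0 \<Longrightarrow> wxx z + wyy z \<ge> 0"
    and left: "\<And>y. 0 < y \<Longrightarrow> y \<le> y0 \<Longrightarrow> w (0, y) \<le> 0"
    and right: "\<And>y. 0 < y \<Longrightarrow> y \<le> y0 \<Longrightarrow> has_normal_derivative w 0 (x0, y) (1, 0)"
    and bottom: "\<And>x. 0 \<le> x \<Longrightarrow> x \<le> x0 \<Longrightarrow> has_normal_derivative w 0 (x, 0) (0, - 1)"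
    and top: "\<And>x. 0 \<le> x \<Longrightarrow> x \<le> x0 \<Longrightarrow> has_normal_derivative w 0 (x, y0) (0, 1)"
    and z: "z \<in> {0..x0} \<times> {0..y0}"
  shows "w z \<le> 0"
proof -
  let ?R = "{0..x0} \<times> {0..y0}" and ?\<phi> = "barrier x0 y0"
  have perturbed: "w z + e * ?\<phi> z \<le> e * y0\<^sup>2" if e: "e > 0" for e
  proof -
    define v where "v z = w z + e * ?\<phi> z" for z
    have "continuous_on ?R v"
      unfolding v_def barrier_def case_prod_unfold by (intro continuous_intros cont)
    moreover have "compact ?R" by (intro compact_Times) auto
    ultimately obtain m where m: "m \<in> ?R" and max: "\<And>z. z \<in> ?R \<Longrightarrow> v z \<le> v m"
      using continuous_attains_sup[of ?R v] z by blast
    obtain x y where xy: "m = (x, y)" by (cases m)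
    have x: "0 \<le> x" "x \<le> x0" and y: "0 \<le> y" "y \<le> y0"
      using m xy by auto
    have normal: "has_normal_derivative v (e * d) z n"
      if "has_normal_derivative w 0 z n" "has_normal_derivative ?\<phi> d z n" for z n d
      using has_normal_derivative_add_cmult[OF that, of e] by (simp add: v_def[abs_def])
    \<comment> \<open>The horizontal sides are excluded first: they contain all four corners, in particular the
      point \<open>(0, 0)\<close>, where the hypothesis on the Dirichlet side says nothing.\<close>
    have "y \<noteq> 0"
    proof
      assume "y = 0"
      have "0 \<le> e * - y0"
        by (rule has_normal_derivative_nonneg_at_max[OF normal[OF bottom barrier_normal_derivative(2)] pos(2)])
          (use x y max xy \<open>y = 0\<close> in auto)
      with e pos show False by (simp add: mult_le_0_iff)
    qed
    moreover have "y \<noteq> y0"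
    proof
      assume "y = y0"
      have "0 \<le> e * - y0"
        by (rule has_normal_derivative_nonneg_at_max[OF normal[OF top barrier_normal_derivative(3)] pos(2)])
          (use x y max xy \<open>y = y0\<close> in auto)
      with e pos show False by (simp add: mult_le_0_iff)
    qed
    ultimately have y': "0 < y" "y < y0" using y by auto
    have "x \<noteq> x0"
    proof
      assume "x = x0"
      have "0 \<le> e * - x0"
        by (rule has_normal_derivative_nonneg_at_max[OF normal[OF right barrier_normal_derivative(1)] pos(1)])
          (use x y' max xy \<open>x = x0\<close> in auto)
      with e pos show False by (simp add: mult_le_0_iff)
    qed
    have "x = 0"
    proof (rule ccontr)
      assume "x \<noteq> 0"
      then have x': "0 < x" "x < x0" using x \<open>x \<noteq> x0\<close> by auto
      then have in_rect: "(x, y) \<in> rect x0 y0" using y' by (simp add: rect_def)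
      have "wxx (x, y) + e * 4 \<le> 0"
      proof (rule second_derivative_nonpos_at_local_max[OF x',
            where f = "\<lambda>s. v (s, y)" and f' = "\<lambda>s. wx (s, y) + e * (4 * s - 5 * x0)"])
        fix s assume s: "0 < s" "s < x0"
        then have "(s, y) \<in> rect x0 y0" using y' by (simp add: rect_def)
        from wx[OF this] show "((\<lambda>s. v (s, y)) has_real_derivative wx (s, y) + e * (4 * s - 5 * x0)) (at s)"
          unfolding v_def barrier_def by (auto intro!: derivative_eq_intros)
        show "v (s, y) \<le> v (x, y)" using max[of "(s, y)"] s y xy by auto
      next
        show "((\<lambda>s. wx (s, y) + e * (4 * s - 5 * x0)) has_real_derivative wxx (x, y) + e * 4) (at x)"
          using wxx[OF in_rect] by (auto intro!: derivative_eq_intros)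
      qed
      moreover have "wyy (x, y) + e * (- 2) \<le> 0"
      proof (rule second_derivative_nonpos_at_local_max[OF y',
            where f = "\<lambda>t. v (x, t)" and f' = "\<lambda>t. wy (x, t) + e * (y0 - 2 * t)"])
        fix t assume t: "0 < t" "t < y0"
        then have "(x, t) \<in> rect x0 y0" using x' by (simp add: rect_def)
        from wy[OF this] show "((\<lambda>t. v (x, t)) has_real_derivative wy (x, t) + e * (y0 - 2 * t)) (at t)"
          unfolding v_def barrier_def by (auto intro!: derivative_eq_intros)
        show "v (x, t) \<le> v (x, y)" using max[of "(x, t)"] t x xy by auto
      next
        show "((\<lambda>t. wy (x, t) + e * (y0 - 2 * t)) has_real_derivative wyy (x, y) + e * (- 2)) (at y)"
          using wyy[OF in_rect] by (auto intro!: derivative_eq_intros)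
      qed
      ultimately show False using subharmonic[OF in_rect] e by simp
    qed
    have "v z \<le> v m" using max z by blast
    also have "v m \<le> e * (y * (y0 - y))"
      using left[of y] y' \<open>x = 0\<close> xy by (simp add: v_def barrier_def)
    also have "\<dots> \<le> e * y0\<^sup>2"
      unfolding power2_eq_square using e y' by (intro mult_left_mono mult_mono) auto
    finally show ?thesis by (simp add: v_def)
  qed
  show ?thesis
  proof (rule ccontr)
    assume "\<not> w z \<le> 0"
    \<comment> \<open>With \<open>e = w z / (2 * K)\<close> the bound for the perturbed function gives \<open>w z \<le> w z / 2\<close>;
      the summand \<open>1\<close> keeps \<open>K\<close> away from \<open>0\<close>.\<close>
    define K where "K = \<bar>y0\<^sup>2 - ?\<phi> z\<bar> + 1"
    have "K > 0" by (simp add: K_def add_nonneg_pos)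
    have "w z \<le> w z / (2 * K) * (y0\<^sup>2 - ?\<phi> z)"
      using perturbed[of "w z / (2 * K)"] \<open>\<not> w z \<le> 0\<close> \<open>K > 0\<close> by (simp add: algebra_simps)
    also have "\<dots> \<le> w z / (2 * K) * K"
      using \<open>\<not> w z \<le> 0\<close> \<open>K > 0\<close> by (intro mult_left_mono) (auto simp: K_def)
    also have "\<dots> = w z / 2" using \<open>K > 0\<close> by simp
    finally show False using \<open>\<not> w z \<le> 0\<close> by simp
  qed
qed

section \<open>Uniqueness for the continuous and the discrete system\<close>

lemma C1_on_partial_derivatives:
  assumes "C1_on S f" "(x, y) \<in> S"
  shows "((\<lambda>s. f (s, y)) has_real_derivative partial_x f (x, y)) (at x)"
    and "((\<lambda>t. f (x, t)) has_real_derivative partial_y f (x, y)) (at y)"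
  using assms by (auto simp: C1_on_def partial_x_def partial_y_def DERIV_deriv_iff_real_differentiable)

text \<open>The difference of two solutions satisfies the homogeneous problem, to which the maximum
  principle applies.  The statement is symmetric in \<open>u\<close> and \<open>v\<close>, so it amounts to uniqueness.\<close>

lemma solves_S_le:
  assumes pos: "x0 > 0" "y0 > 0"
    and u: "solves_S x0 y0 g q b u" and v: "solves_S x0 y0 g q b v"
    and z: "z \<in> {0..x0} \<times> {0..y0}"
  shows "u z \<le> v z"
proof -
  have cl: "closure (rect x0 y0) = {0..x0} \<times> {0..y0}"
    using pos by (simp add: rect_def closure_Times closure_greaterThanLessThan)
  have C: "C1_on (rect x0 y0) f" "C1_on (rect x0 y0) (partial_x f)" "C1_on (rect x0 y0) (partial_y f)"
    if "f = u \<or> f = v" for f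
    using that u v by (auto simp: solves_S_def C2_on_def)
  have "(\<lambda>z. u z - v z) z \<le> 0"
  proof (rule mixed_max_principle[OF pos, where
        wx = "\<lambda>z. partial_x u z - partial_x v z" and
        wy = "\<lambda>z. partial_y u z - partial_y v z" and
        wxx = "\<lambda>z. partial_x (partial_x u) z - partial_x (partial_x v) z" and
        wyy = "\<lambda>z. partial_y (partial_y u) z - partial_y (partial_y v) z"])
    show "continuous_on ({0..x0} \<times> {0..y0}) (\<lambda>z. u z - v z)"
      using u v by (intro continuous_on_diff) (simp_all add: solves_S_def cl)
    fix z assume "z \<in> rect x0 y0"
    then have "- laplacian u z = g" "- laplacian v z = g"
      using u v by (auto simp: solves_S_def)
    then show "0 \<le> partial_x (partial_x u) z - partial_x (partial_x v) z +
        (partial_y (partial_y u) z - partial_y (partial_y v) z)"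
      by (simp add: laplacian_def)
  next
    fix y assume "0 < y" "y \<le> y0"
    then show "has_normal_derivative (\<lambda>z. u z - v z) 0 (x0, y) (1, 0)"
      using u v has_normal_derivative_diff[of u "- q" "(x0, y)" "(1, 0)" v "- q"]
      by (auto simp: solves_S_def)
    show "u (0, y) - v (0, y) \<le> 0"
      using u v \<open>0 < y\<close> \<open>y \<le> y0\<close> by (auto simp: solves_S_def)
  next
    fix x assume "0 \<le> x" "x \<le> x0"
    then show "has_normal_derivative (\<lambda>z. u z - v z) 0 (x, 0) (0, - 1)"
      "has_normal_derivative (\<lambda>z. u z - v z) 0 (x, y0) (0, 1)"
      using u v has_normal_derivative_diff[of u 0 "(x, 0)" "(0, - 1)" v 0]
        has_normal_derivative_diff[of u 0 "(x, y0)" "(0, 1)" v 0]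
      by (auto simp: solves_S_def)
  qed (use z in \<open>auto intro!: DERIV_diff C1_on_partial_derivatives C\<close>)
  then show ?thesis by simp
qed

lemma solves_S_imp_explicit:
  assumes "x0 > 0" "y0 > 0" "solves_S x0 y0 g q b u" "x \<in> {0..x0}" "y \<in> {0..y0}"
  shows "u (x, y) = - g / 2 * x\<^sup>2 + (g * x0 - q) * x + b"
  using solves_S_le[OF assms(1,2) assms(3) solves_S_explicit[OF assms(1,2), of g q b], of "(x, y)"]
    solves_S_le[OF assms(1,2) solves_S_explicit[OF assms(1,2), of g q b] assms(3), of "(x, y)"]
    assms(4,5) by auto

text \<open>The Neumann equation gives the last increment, and each interior equation passes from one
  increment to the preceding one; hence the induction runs downwards from \<open>n\<close>.\<close>

lemma solves_modified_discrete_increment: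
  assumes U: "solves_modified_discrete g q b h n U" and i: "1 \<le> i" "i \<le> n"
  shows "U (i + 1) - U i = g * h\<^sup>2 * (real n - real i + 1 / 2) - q * h"
  using i(2)
proof (induction rule: inc_induct)
  case base
  then show ?case using U by (simp add: solves_modified_discrete_def)
next
  case (step k)
  then have "Suc k \<in> {2..n}" using i by auto
  with U have "U (Suc k + 1) - 2 * U (Suc k) + U (Suc k - 1) = - g * h\<^sup>2"
    unfolding solves_modified_discrete_def by blast
  with step.IH show ?case by (simp add: algebra_simps)
qed

text \<open>The nodal values are those of the exact solution, since \<open>n * h = x0\<close>.\<close>

lemma solves_modified_discrete_imp_explicit:
  assumes U: "solves_modified_discrete g q b h n U" and i: "1 \<le> i" "i \<le> n + 1"
  shows "U i = - g / 2 * (node h i)\<^sup>2 + (g * (real n * h) - q) * node h i + b"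
  using i
proof (induction i rule: nat_induct_at_least)
  case base
  then show ?case using U by (simp add: solves_modified_discrete_def node_def)
next
  case (Suc i)
  then have "U (i + 1) = U i + (g * h\<^sup>2 * (real n - real i + 1 / 2) - q * h)"
    using solves_modified_discrete_increment[OF U, of i] by simp
  with Suc show ?case by (simp add: node_def algebra_simps power2_eq_square)
qed

section \<open>Square integrals of functions that repeat one profile on every strip\<close>

lemma has_bochner_integral_tensor_lborel:
  fixes f g :: "real \<Rightarrow> real"
  assumes f: "has_bochner_integral lborel f I" and g: "has_bochner_integral lborel g J"
  shows "has_bochner_integral lborel (\<lambda>z. f (fst z) * g (snd z)) (I * J)"
proof -
  have [measurable]: "f \<in> borel_measurable borel" "g \<in> borel_measurable borel"
    and fi: "integrable lborel f" and gi: "integrable lborel g"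
    using f g by (auto simp: has_bochner_integral_iff)
  have "integrable (lborel \<Otimes>\<^sub>M lborel) (\<lambda>z. f (fst z) * g (snd z))"
    by (rule lborel_pair.Fubini_integrable)
      (use fi gi in \<open>simp_all add: abs_mult integrable_mult_left\<close>)
  moreover from lborel_pair.integral_fst'[OF this]
  have "integral\<^sup>L (lborel \<Otimes>\<^sub>M lborel) (\<lambda>z. f (fst z) * g (snd z)) = I * J"
    using has_bochner_integral_integral_eq[OF f] has_bochner_integral_integral_eq[OF g] by simp
  ultimately show ?thesis
    by (simp add: has_bochner_integral_iff lborel_prod)
qed

lemma AE_lebesgue_fst_notin_finite:
  assumes "finite A"
  shows "AE z in (lebesgue :: (real \<times> real) measure). fst z \<notin> A"
proof -
  have "negligible (\<Union>a\<in>A. {z :: real \<times> real. z \<bullet> (1, 0) = a})"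
    using assms by (intro negligible_Union) (auto intro!: negligible_standard_hyperplane simp: Basis_prod_def)
  then show ?thesis
    unfolding negligible_iff_null_sets by (rule AE_I') auto
qed

text \<open>Up to the vertical lines through the nodes, \<open>f\<close> is a sum of translates of \<open>p\<close> in \<open>x\<close>, cut off
  to one strip each, times an indicator in \<open>y\<close>; Fubini and translation invariance give the
  integral.  Nothing is assumed about \<open>f\<close> on those lines, because a piecewise linear
  function need not be differentiable there; completeness of Lebesgue measure makes \<open>f\<close> measurable
  nevertheless.\<close>

lemma L2_norm_on_periodic_profile:
  fixes f :: "real \<times> real \<Rightarrow> real"
  assumes h: "h > 0" and y0: "y0 > 0" and p: "p \<in> borel_measurable borel"
    and J: "has_bochner_integral lborel (\<lambda>t. indicator {0..h} t * (p t)\<^sup>2) J"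
    and f: "\<And>i x y. i < n \<Longrightarrow> real i * h < x \<Longrightarrow> x < (real i + 1) * h \<Longrightarrow> 0 < y \<Longrightarrow> y < y0 \<Longrightarrow>
      f (x, y) = p (x - real i * h)"
  shows "in_L2_on (rect (real n * h) y0) f"
    and "L2_norm_on (rect (real n * h) y0) f = sqrt (real n * J * y0)"
proof -
  let ?R = "rect (real n * h) y0"
  define F where "F r z = (\<Sum>i<n. (indicator {0..h} (fst z - real i * h) * r (fst z - real i * h)))
      * indicator {0<..<y0} (snd z)" for r :: "real \<Rightarrow> real" and z :: "real \<times> real"
  \<comment> \<open>\<open>F p\<close> is the Borel model of \<open>f\<close>, and \<open>F\<close> of the squared profile that of the square of \<open>f\<close>.
    The closed strips overlap, but only over nodes.\<close>
  have F_meas: "F r \<in> borel_measurable lebesgue" if "r \<in> borel_measurable borel" for r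
  proof -
    note [measurable] = that
    have "F r \<in> borel_measurable (borel \<Otimes>\<^sub>M borel)"
      unfolding F_def[abs_def] by measurable
    then show ?thesis
      by (intro measurable_completion) (simp add: borel_prod)
  qed
  have AE_F: "AE z in lebesgue. F r z = indicator ?R z *\<^sub>R k (f z)"
    if "\<And>t. r t = k (p t)" for r and k :: "real \<Rightarrow> real"
  proof -
    have "AE z in lebesgue. fst (z :: real \<times> real) \<notin> (\<lambda>i. real i * h) ` {..n}"
      by (rule AE_lebesgue_fst_notin_finite) simp
    then show ?thesis
    proof eventually_elim
      case (elim z)
      obtain x y where z: "z = (x, y)" by (cases z)
      have off: "x \<noteq> real i * h" if "i \<le> n" for i using elim z that by auto
      show ?case
      proof (cases "0 < x \<and> x < real n * h")
        case False
        have "indicator {0..h} (x - real i * h) = (0::real)" if "i < n" for i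
        proof -
          have "real i * h \<ge> 0" "real i * h + h \<le> real n * h"
            using that h mult_right_mono[of "real i + 1" "real n" h] by (auto simp: algebra_simps)
          with False off[of n] off[of 0] show ?thesis by (auto simp: indicator_def)
        qed
        then have "F r z = 0" by (simp add: F_def z)
        moreover have "z \<notin> ?R" using False by (auto simp: z rect_def)
        ultimately show ?thesis by simp
      next
        case True
        define j where "j = nat \<lfloor>x / h\<rfloor>"
        have fl: "real j = of_int \<lfloor>x / h\<rfloor>" using True h by (simp add: j_def)
        have le: "real j * h \<le> x" and lt: "x < (real j + 1) * h"
          using h of_int_floor_le[of "x / h"] real_of_int_floor_add_one_gt[of "x / h"] unfolding fl
          by (simp_all only: pos_le_divide_eq pos_divide_less_eq)
        have "real j * h < real n * h" using le True by linarith
        then have j: "j < n" using h by simp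
        have lt': "real j * h < x" using le off[of j] j by simp
        have other: "indicator {0..h} (x - real i * h) = (0::real)" if "i < n" "i \<noteq> j" for i
        proof (cases "i < j")
          case True
          then have "(real i + 1) * h \<le> real j * h"
            using h by (intro mult_right_mono) auto
          then show ?thesis using lt' by (auto simp: indicator_def algebra_simps)
        next
          case False
          then have "(real j + 1) * h \<le> real i * h"
            using h that by (intro mult_right_mono) auto
          then show ?thesis using lt by (auto simp: indicator_def)
        qed
        have "(\<Sum>i<n. (indicator {0..h} (x - real i * h) * r (x - real i * h)))
            = (\<Sum>i\<in>{j}. (indicator {0..h} (x - real i * h) * r (x - real i * h)))"
          by (rule sum.mono_neutral_right) (use j other in auto)
        also have "\<dots> = k (p (x - real j * h))"
          using lt lt' that by (simp add: indicator_def algebra_simps)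
        finally show ?thesis
          using True f[OF j lt' lt, of y] by (auto simp: F_def z rect_def indicator_def)
      qed
    qed
  qed
  let ?sq = "\<lambda>t. (p t)\<^sup>2"
  have "has_bochner_integral lborel (\<lambda>x. indicator {0..h} (x - real i * h) * ?sq (x - real i * h)) J" for i
    using J lborel_has_bochner_integral_real_affine_iff[of 1 "\<lambda>t. indicator {0..h} t * ?sq t" J "- (real i * h)"]
    by simp
  from has_bochner_integral_sum[of "{..<n}", OF this]
  have "has_bochner_integral lborel
      (\<lambda>x. \<Sum>i<n. (indicator {0..h} (x - real i * h) * ?sq (x - real i * h))) (real n * J)"
    by simp
  moreover have "has_bochner_integral lborel (indicator {0<..<y0}) y0"
    using has_bochner_integral_real_indicator[of "{0<..<y0}" lborel] y0 by simp
  ultimately have "has_bochner_integral lborel (F ?sq) (real n * J * y0)"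
    unfolding F_def[abs_def] by (rule has_bochner_integral_tensor_lborel)
  then have F_int: "has_bochner_integral lebesgue (F ?sq) (real n * J * y0)"
    using integrable_completion[OF borel_measurable_has_bochner_integral]
      integral_completion[OF borel_measurable_has_bochner_integral]
    by (metis has_bochner_integral_iff)
  have p2: "?sq \<in> borel_measurable borel" using p by measurable
  have AE2: "AE z in lebesgue. F ?sq z = indicator ?R z *\<^sub>R (f z)\<^sup>2" by (rule AE_F) simp
  have "(\<lambda>z. indicator ?R z *\<^sub>R (f z)\<^sup>2) \<in> borel_measurable lebesgue"
    by (rule borel_measurable_AE[OF F_meas[OF p2] AE2])
  then have f_int: "has_bochner_integral lebesgue (\<lambda>z. indicator ?R z *\<^sub>R (f z)\<^sup>2) (real n * J * y0)"
    using F_int has_bochner_integral_cong_AE[OF F_meas[OF p2] _ AE2] by simp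
  moreover have "(\<lambda>z. indicator ?R z *\<^sub>R f z) \<in> borel_measurable lebesgue"
    by (rule borel_measurable_AE[OF F_meas[OF p] AE_F]) simp
  ultimately show "in_L2_on ?R f"
    by (simp add: in_L2_on_def set_borel_measurable_def set_integrable_def has_bochner_integral_iff)
  show "L2_norm_on ?R f = sqrt (real n * J * y0)"
    using has_bochner_integral_integral_eq[OF f_int]
    by (simp add: L2_norm_on_def set_lebesgue_integral_def)
qed

section \<open>The discretisation error\<close>

lemma integral_square_parabola:
  fixes h c :: real
  assumes "h > 0"
  shows "has_bochner_integral lborel (\<lambda>t. indicator {0..h} t * (c / 2 * t * (h - t))\<^sup>2) (c\<^sup>2 * h ^ 5 / 120)"
proof -
  let ?F = "\<lambda>t. c\<^sup>2 / 4 * (h\<^sup>2 * t ^ 3 / 3 - h * t ^ 4 / 2 + t ^ 5 / 5)"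
  have "has_bochner_integral lborel (\<lambda>t. indicator {0..h} t *\<^sub>R (c / 2 * t * (h - t))\<^sup>2) (?F h - ?F 0)"
  proof (rule has_bochner_integral_FTC_Icc)
    fix t
    have "(?F has_real_derivative (c / 2 * t * (h - t))\<^sup>2) (at t)"
      by (auto intro!: derivative_eq_intros simp: field_simps power2_eq_square eval_nat_numeral)
    then show "(?F has_vector_derivative (c / 2 * t * (h - t))\<^sup>2) (at t within {0..h})"
      by (simp add: has_real_derivative_iff_has_vector_derivative has_vector_derivative_at_within)
  qed (use assms in \<open>auto intro!: continuous_intros\<close>)
  moreover have "?F h - ?F 0 = c\<^sup>2 * h ^ 5 / 120" by (simp add: eval_nat_numeral field_simps)
  ultimately show ?thesis by (simp only: real_scaleR_def)
qed

lemma integral_square_line: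
  fixes h c :: real
  assumes "h > 0"
  shows "has_bochner_integral lborel (\<lambda>t. indicator {0..h} t * (c * (h / 2 - t))\<^sup>2) (c\<^sup>2 * h ^ 3 / 12)"
proof -
  let ?F = "\<lambda>t. c\<^sup>2 * (h\<^sup>2 * t / 4 - h * t\<^sup>2 / 2 + t ^ 3 / 3)"
  have "has_bochner_integral lborel (\<lambda>t. indicator {0..h} t *\<^sub>R (c * (h / 2 - t))\<^sup>2) (?F h - ?F 0)"
  proof (rule has_bochner_integral_FTC_Icc)
    fix t
    have "(?F has_real_derivative (c * (h / 2 - t))\<^sup>2) (at t)"
      by (auto intro!: derivative_eq_intros simp: field_simps power2_eq_square eval_nat_numeral)
    then show "(?F has_vector_derivative (c * (h / 2 - t))\<^sup>2) (at t within {0..h})"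
      by (simp add: has_real_derivative_iff_has_vector_derivative has_vector_derivative_at_within)
  qed (use assms in \<open>auto intro!: continuous_intros\<close>)
  moreover have "?F h - ?F 0 = c\<^sup>2 * h ^ 3 / 12" by (simp add: eval_nat_numeral field_simps)
  ultimately show ?thesis by (simp only: real_scaleR_def)
qed

text \<open>The product formula is the remainder of linear interpolation for a quadratic with second
  derivative \<open>- g\<close>.  The strip is open, so both functions agree with polynomials in \<open>x\<close> near the
  given point, and these determine the partial derivatives.  Strips are counted from \<open>0\<close> here: the
  left node of strip \<open>i\<close> is \<open>node h (i + 1) = i * h\<close>.\<close>

lemma interpolation_error_on_strip:
  assumes pos: "x0 > 0" "y0 > 0" and n: "n \<ge> 1" and h: "h = x0 / real n"
    and u: "solves_S x0 y0 g q b u"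
    and U: "solves_modified_discrete g q b h n U"
    and uh: "piecewise_linear_interpolant y0 h n U uh"
    and i: "i < n" and x: "real i * h < x" "x < (real i + 1) * h" and y: "0 < y" "y < y0"
  shows "u (x, y) - uh (x, y) = g / 2 * (x - real i * h) * (h - (x - real i * h))"
    and "partial_x u (x, y) - partial_x uh (x, y) = g * (h / 2 - (x - real i * h))"
proof -
  let ?I = "{real i * h<..<(real i + 1) * h}"
  let ?P = "\<lambda>s. - g / 2 * s\<^sup>2 + (g * x0 - q) * s + b"
  let ?Q = "\<lambda>s. ?P s - g / 2 * (s - real i * h) * (h - (s - real i * h))"
  have hpos: "h > 0" and nh: "real n * h = x0" using pos n h by auto
  have u_eq: "u (s, y) = ?P s" if "s \<in> ?I" for s
  proof -
    have "(real i + 1) * h \<le> x0" using nh i hpos mult_right_mono[of "real i + 1" "real n" h] by simp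
    moreover have "real i * h \<ge> 0" using hpos by simp
    ultimately have "s \<in> {0..x0}" using that by auto
    then show ?thesis using solves_S_imp_explicit[OF pos u] y by simp
  qed
  have uh_eq: "uh (s, y) = ?Q s" if "s \<in> ?I" for s
  proof -
    let ?k = "i + 1"
    have k: "?k \<in> {1..n}" using i by simp
    have "s \<in> {node h ?k..node h (?k + 1)}" "y \<in> {0..y0}"
      using that y by (auto simp: node_def algebra_simps)
    with uh k have "uh (s, y) = U ?k + (U (?k + 1) - U ?k) / h * (s - node h ?k)"
      unfolding piecewise_linear_interpolant_def by blast
    moreover have "(U (?k + 1) - U ?k) / h = - g / 2 * (2 * real i + 1) * h + (g * x0 - q)"
      using solves_modified_discrete_increment[OF U, of ?k] k hpos
      by (simp add: field_simps power2_eq_square nh[symmetric])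
    moreover have "U ?k = ?P (real i * h)"
      using solves_modified_discrete_imp_explicit[OF U, of ?k] k by (simp add: node_def nh)
    ultimately show ?thesis
      by (simp only:) (simp add: node_def algebra_simps power2_eq_square add_divide_distrib diff_divide_distrib)
  qed
  have x': "x \<in> ?I" using x by simp
  show "u (x, y) - uh (x, y) = g / 2 * (x - real i * h) * (h - (x - real i * h))"
    using u_eq[OF x'] uh_eq[OF x'] by simp
  have "((\<lambda>s. u (s, y)) has_real_derivative - g * x + (g * x0 - q)) (at x)"
    by (rule has_field_derivative_transform_within_open[where f = ?P and S = ?I])
      (use x' u_eq in \<open>auto intro!: derivative_eq_intros\<close>)
  moreover have "((\<lambda>s. uh (s, y)) has_real_derivative
      - g * x + (g * x0 - q) - g * (h / 2 - (x - real i * h))) (at x)"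
    by (rule has_field_derivative_transform_within_open[where f = ?Q and S = ?I])
      (use x' uh_eq in \<open>auto intro!: derivative_eq_intros simp: field_simps\<close>)
  ultimately show "partial_x u (x, y) - partial_x uh (x, y) = g * (h / 2 - (x - real i * h))"
    by (simp add: partial_x_def DERIV_imp_deriv)
qed

theorem lemma21:
  fixes x0 y0 g q b h :: real
    and n :: nat
    and u uh :: "real \<times> real \<Rightarrow> real"
    and U :: "nat \<Rightarrow> real"
  assumes "x0 > 0" and "y0 > 0"
    and "n \<ge> 1" and "h = x0 / real n"
    and "solves_S x0 y0 g q b u"
    and "solves_modified_discrete g q b h n U"
    and "piecewise_linear_interpolant y0 h n U uh"
  shows "in_L2_on (rect x0 y0) (\<lambda>z. u z - uh z)
    \<and> L2_norm_on (rect x0 y0) (\<lambda>z. u z - uh z) \<le> sqrt (x0 * y0 / 120) * \<bar>g\<bar> * h\<^sup>2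
    \<and> in_L2_on (rect x0 y0) (\<lambda>z. partial_x u z - partial_x uh z)
    \<and> L2_norm_on (rect x0 y0) (\<lambda>z. partial_x u z - partial_x uh z)
        \<le> sqrt (x0 * y0 / 12) * \<bar>g\<bar> * h"
proof -
  have h: "h > 0" and nh: "real n * h = x0" using assms by auto
  note error = interpolation_error_on_strip[OF assms]
  note value_norm = L2_norm_on_periodic_profile[OF h \<open>y0 > 0\<close> _ integral_square_parabola[OF h],
      where f = "\<lambda>z. u z - uh z" and n = n, OF _ error(1), unfolded nh]
  note slope_norm = L2_norm_on_periodic_profile[OF h \<open>y0 > 0\<close> _ integral_square_line[OF h],
      where f = "\<lambda>z. partial_x u z - partial_x uh z" and n = n, OF _ error(2), unfolded nh]
  have "real n * (g\<^sup>2 * h ^ 5 / 120) * y0 = x0 * y0 / 120 * (\<bar>g\<bar> * h\<^sup>2)\<^sup>2"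
    by (simp add: nh[symmetric] power_mult_distrib eval_nat_numeral)
  then have "sqrt (real n * (g\<^sup>2 * h ^ 5 / 120) * y0) = sqrt (x0 * y0 / 120) * (\<bar>g\<bar> * h\<^sup>2)"
    by (simp only: real_sqrt_mult real_sqrt_abs) (simp add: abs_mult)
  moreover have "real n * (g\<^sup>2 * h ^ 3 / 12) * y0 = x0 * y0 / 12 * (\<bar>g\<bar> * h)\<^sup>2"
    by (simp add: nh[symmetric] power_mult_distrib eval_nat_numeral)
  then have "sqrt (real n * (g\<^sup>2 * h ^ 3 / 12) * y0) = sqrt (x0 * y0 / 12) * (\<bar>g\<bar> * h)"
    using h by (simp only: real_sqrt_mult real_sqrt_abs) (simp add: abs_mult)
  ultimately show ?thesis
    using value_norm slope_norm by (simp add: mult.assoc)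
qed

end
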